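(* Let $G$ be a triangle-free graph, let $e=uv$ be an edge of $G$, and let $G\cdot e$ be the graph obtained from $G$ by contracting $e$ to a new vertex $w$. Then $$\frac{mp(G)}{3}\leq mp(G\cdot e)\leq 2\,mp(G).$$
   Context: All graphs are finite, simple, undirected, with non-empty vertex set. A path $v_1v_2\ldots v_k$ (distinct vertices, consecutive ones adjacent, $k\ge 1$) in a graph $G$ is degree monotone if $\deg(v_1)\le \deg(v_2)\le\dots\le\deg(v_k)$ or $\deg(v_1)\ge\deg(v_2)\ge\dots\ge\deg(v_k)$, where degrees are taken in $G$. The length of a degree monotone path is its number of vertices, and $mp(G)$ is the maximum length of a degree monotone path in $G$. Contracting an edge $e=uv$ means replacing $u$ and $v$ by a single new vertex $w$ adjacent (without multiple edges) to exactly the vertices of $(N(u)\setminus\{v\})\cup(N(v)\setminus\{u\})$; the resulting graph is denoted $G\cdot e$. *)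

theory Defs
  imports Complex_Main "Graph_Theory.Graph_Theory"
begin

text \<open>
  A finite simple graph is a \<^locale>\<open>pair_graph\<close>: a finite, loop-free, symmetric digraph whose
  arcs are ordered pairs. An undirected edge \<open>xy\<close> is thus represented by the two arcs
  \<open>(x, y)\<close> and \<open>(y, x)\<close>, and the degree of a vertex is its out-degree.
\<close>

definition neighbors :: "'a pair_pre_digraph \<Rightarrow> 'a \<Rightarrow> 'a set" where
  "neighbors G x = {y. (x, y) \<in> parcs G}"

abbreviation degree :: "'a pair_pre_digraph \<Rightarrow> 'a \<Rightarrow> nat" where
  "degree G x \<equiv> out_degree (with_proj G) x"

definition triangle_free :: "'a pair_pre_digraph \<Rightarrow> bool" where
  "triangle_free G \<longleftrightarrow>
     \<not> (\<exists>x y z. (x, y) \<in> parcs G \<and> (y, z) \<in> parcs G \<and> (z, x) \<in> parcs G)"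

definition degree_monotone_path :: "'a pair_pre_digraph \<Rightarrow> 'a list \<Rightarrow> bool" where
  "degree_monotone_path G p \<longleftrightarrow>
     vpath p (with_proj G) \<and>
     (sorted_wrt (\<le>) (map (degree G) p) \<or> sorted_wrt (\<ge>) (map (degree G) p))"

text \<open>The length of a path is its number of vertices, not its number of edges.\<close>

definition mp :: "'a pair_pre_digraph \<Rightarrow> nat" where
  "mp G = Max {length p | p. degree_monotone_path G p}"

text \<open>
  The contraction of the edge \<open>uv\<close> to the vertex \<open>w\<close>; it is meant for \<open>w\<close> not a vertex of \<open>G\<close>.
\<close>

definition contract_edge ::
  "'a pair_pre_digraph \<Rightarrow> 'a \<Rightarrow> 'a \<Rightarrow> 'a \<Rightarrow> 'a pair_pre_digraph" where
  "contract_edge G u v w =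
     (let N = (neighbors G u - {v}) \<union> (neighbors G v - {u}) in
      \<lparr> pverts = (pverts G - {u, v}) \<union> {w},
        parcs = {(x, y) \<in> parcs G. x \<notin> {u, v} \<and> y \<notin> {u, v}} \<union> {w} \<times> N \<union> N \<times> {w} \<rparr>)"

lemma pair_graph_contract_edge:
  assumes "pair_graph G" and w: "w \<notin> pverts G"
  shows "pair_graph (contract_edge G u v w)"
proof -
  interpret pair_graph G by fact
  let ?H = "contract_edge G u v w"
  have N: "neighbors G x \<subseteq> pverts G" for x
    by (auto simp: neighbors_def dest: in_arcsD2)
  have sym: "(y, x) \<in> parcs G" if "(x, y) \<in> parcs G" for x y
    using that by (rule arcs_symmetric)
  have fin: "finite (neighbors G x)" for x
    using N pair_finite_verts by (rule finite_subset)
  have noloop: "(x, x) \<notin> parcs G" for x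
    using no_loops' by blast
  have wf: "fst e \<in> pverts ?H \<and> snd e \<in> pverts ?H \<and> fst e \<noteq> snd e" if "e \<in> parcs ?H" for e
    using that w noloop
    by (cases e) (auto simp: contract_edge_def Let_def neighbors_def dest: in_arcsD1 in_arcsD2)
  have "finite {(x, y) \<in> parcs G. x \<notin> {u, v} \<and> y \<notin> {u, v}}"
    by (rule finite_subset[OF _ pair_finite_arcs]) auto
  then have finarcs: "finite (parcs ?H)"
    using fin by (auto simp: contract_edge_def Let_def)
  have "symmetric (with_proj ?H)"
    by (auto simp: symmetric_def sym_def contract_edge_def Let_def intro: sym)
  then show ?thesis
    using wf finarcs pair_finite_verts
    by unfold_locales (auto simp: contract_edge_def Let_def)
qed

text \<open>The maximum in the definition of \<open>mp\<close> is over a finite non-empty set.\<close>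

lemma finite_degree_monotone_path_lengths:
  assumes "pair_graph G"
  shows "finite {length p | p. degree_monotone_path G p}"
proof -
  interpret pair_graph G by fact
  have "length p \<le> card (pverts G)" if "degree_monotone_path G p" for p
    using that card_mono[OF pair_finite_verts, of "set p"]
    by (auto simp: degree_monotone_path_def vpath_def vwalk_def distinct_card)
  then show ?thesis
    by (intro finite_subset[OF _ finite_atMost[of "card (pverts G)"]]) auto
qed

lemma degree_monotone_path_singleton:
  "x \<in> pverts G \<Longrightarrow> degree_monotone_path G [x]"
  by (auto simp: degree_monotone_path_def vpath_def vwalk_def)

end

theory Submission
  imports Defs
begin

text \<open>
  As \<open>G\<close> is triangle-free, contraction keeps the degree of every vertex other than \<open>u\<close> and \<open>v\<close>,
  and \<open>w\<close> has degree \<open>deg u + deg v - 2\<close>.  So the paths avoiding \<open>u\<close>, \<open>v\<close>, \<open>w\<close> are degree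
  monotone in \<open>G\<close> if and only if they are in \<open>G \<cdot> e\<close>, and only the pieces around these vertices matter.

  Lower bound: the critical case is a path \<open>A u B v C\<close> with non-decreasing degrees.  Either
  \<open>deg u = 1\<close>, and then \<open>A\<close> and \<open>B\<close> are empty, or \<open>deg u \<ge> 2\<close>, so that \<open>deg w \<ge> deg v\<close> and both
  \<open>A w\<close> and \<open>B w\<close> are degree monotone in \<open>G \<cdot> e\<close>.

  Upper bound: the critical case is a path \<open>A w B\<close> in which \<open>A\<close> and \<open>B\<close> both have \<open>mp G\<close> vertices.
  Since neither can be prolonged by \<open>u\<close> or \<open>v\<close>, the neighbour \<open>x \<in> {u, v}\<close> of the end of \<open>A\<close> has
  smaller degree than that end, and the neighbour \<open>y\<close> of the start of \<open>B\<close> has larger degree than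
  that start.  So \<open>{x, y} = {u, v}\<close> and \<open>deg y > deg w = deg x + deg y - 2\<close>, contradicting
  \<open>deg x \<ge> 2\<close>.
\<close>

section \<open>Paths with non-decreasing degrees\<close>

definition ascending_path :: "'a pair_pre_digraph \<Rightarrow> 'a list \<Rightarrow> bool" where
  "ascending_path G p \<longleftrightarrow> set p \<subseteq> pverts G \<and> distinct p \<and>
     successively (\<lambda>x y. (x, y) \<in> parcs G \<and> degree G x \<le> degree G y) p"

lemma degree_eq_card_neighbors: "degree G x = card (neighbors G x)"
proof -
  have "out_arcs (with_proj G) x = Pair x ` neighbors G x"
    by (auto simp: out_arcs_def neighbors_def)
  then show ?thesis
    by (simp add: out_degree_def card_image inj_on_def)
qed

lemma vwalk_arcs_subset_iff_successively:
  "set (vwalk_arcs p) \<subseteq> A \<longleftrightarrow> successively (\<lambda>x y. (x, y) \<in> A) p"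
  by (induction p rule: vwalk_arcs.induct) auto

lemma successively_conj:
  "successively (\<lambda>x y. P x y \<and> Q x y) p \<longleftrightarrow> successively P p \<and> successively Q p"
  by (induction p rule: induct_list012) auto

lemma ascending_path_append:
  "ascending_path G (p @ q) \<longleftrightarrow>
     ascending_path G p \<and> ascending_path G q \<and> set p \<inter> set q = {} \<and>
     (p = [] \<or> q = [] \<or>
       (last p, hd q) \<in> parcs G \<and> degree G (last p) \<le> degree G (hd q))"
  by (auto simp: ascending_path_def successively_append_iff)

lemma ascending_path_Cons:
  "ascending_path G (x # q) \<longleftrightarrow>
     x \<in> pverts G \<and> x \<notin> set q \<and> ascending_path G q \<and>
     (q = [] \<or> (x, hd q) \<in> parcs G \<and> degree G x \<le> degree G (hd q))"
  by (auto simp: ascending_path_def successively_Cons)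

lemma ascending_path_Nil [simp]: "ascending_path G []"
  by (simp add: ascending_path_def)

context pair_graph
begin

lemma finite_neighbors: "finite (neighbors G x)"
  by (rule finite_subset[OF _ pair_finite_verts])
    (auto simp: neighbors_def dest: in_arcsD2)

lemma two_le_degree:
  assumes "(x, y) \<in> parcs G" "(x, z) \<in> parcs G" "y \<noteq> z"
  shows "2 \<le> degree G x"
  using card_mono[OF finite_neighbors, of "{y, z}" x] assms
  by (simp add: degree_eq_card_neighbors neighbors_def)

text \<open>Transitivity of the order lets degrees be compared along arcs only, and symmetry of the
  arcs makes the reversal of a path a path.\<close>

lemma degree_monotone_path_iff_ascending_path:
  "degree_monotone_path G p \<longleftrightarrow> p \<noteq> [] \<and> (ascending_path G p \<or> ascending_path G (rev p))"
proof -
  have sym: "(\<lambda>x y. (y, x) \<in> parcs G) = (\<lambda>x y. (x, y) \<in> parcs G)"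
    by (intro ext) (metis arcs_symmetric)
  have "transp ((\<le>) :: nat \<Rightarrow> nat \<Rightarrow> bool)" "transp ((\<ge>) :: nat \<Rightarrow> nat \<Rightarrow> bool)"
    by (auto simp: transp_def)
  then have "sorted_wrt (\<le>) (map (degree G) p) \<longleftrightarrow>
        successively (\<lambda>x y. degree G x \<le> degree G y) p"
      "sorted_wrt (\<ge>) (map (degree G) p) \<longleftrightarrow>
        successively (\<lambda>x y. degree G x \<ge> degree G y) p"
    by (simp_all only: successively_map flip: successively_conv_sorted_wrt)
  then show ?thesis
    unfolding degree_monotone_path_def vpath_def vwalk_def ascending_path_def
      vwalk_arcs_subset_iff_successively successively_conj successively_rev sym
      with_proj_simps
    by auto
qed

lemma ascending_path_length_le_mp:
  assumes "ascending_path G p"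
  shows "length p \<le> mp G"
proof (cases "p = []")
  case False
  then have "degree_monotone_path G p"
    using assms by (simp add: degree_monotone_path_iff_ascending_path)
  then show ?thesis
    unfolding mp_def
    by (intro Max_ge finite_degree_monotone_path_lengths pair_graph_axioms) auto
qed simp

lemma ex_ascending_path_length_eq_mp:
  assumes "pverts G \<noteq> {}"
  obtains p where "ascending_path G p" "length p = mp G"
proof -
  let ?L = "{length p | p. degree_monotone_path G p}"
  obtain x where "x \<in> pverts G" using assms by blast
  then have "?L \<noteq> {}"
    using degree_monotone_path_singleton[of x G] by auto
  then have "mp G \<in> ?L"
    unfolding mp_def
    by (intro Max_in finite_degree_monotone_path_lengths pair_graph_axioms)
  then obtain p where "degree_monotone_path G p" "length p = mp G"
    by auto
  then show thesis
    using that[of p] that[of "rev p"]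
    by (auto simp: degree_monotone_path_iff_ascending_path)
qed

lemma mp_pos:
  assumes "pverts G \<noteq> {}"
  shows "1 \<le> mp G"
proof -
  from assms obtain x where "x \<in> pverts G" by blast
  then show ?thesis
    using ascending_path_length_le_mp[of "[x]"] by (simp add: ascending_path_def)
qed

end

lemma contract_edge_swap: "contract_edge G v u w = contract_edge G u v w"
  by (auto simp: contract_edge_def Let_def)

section \<open>Degrees and paths under contraction\<close>

locale edge_contraction = pair_graph G for G :: "'a pair_pre_digraph" +
  fixes u v w :: 'a
  assumes triangle_free: "triangle_free G"
    and edge: "(u, v) \<in> parcs G"
    and fresh: "w \<notin> pverts G"
begin

abbreviation H :: "'a pair_pre_digraph" where
  "H \<equiv> contract_edge G u v w"

sublocale H: pair_graph H
  using pair_graph_axioms fresh by (rule pair_graph_contract_edge)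

lemma edge_contraction_swap: "edge_contraction G v u w"
  using triangle_free fresh arcs_symmetric[OF edge] by unfold_locales

lemma uv_in_verts: "u \<in> pverts G" "v \<in> pverts G"
  using edge by (auto dest: in_arcsD1 in_arcsD2)

lemma u_neq_v: "u \<noteq> v"
  using edge no_loops' by blast

lemma w_neq_uv: "w \<noteq> u" "w \<noteq> v"
  using uv_in_verts fresh by auto

lemma no_common_neighbor: "(x, u) \<in> parcs G \<Longrightarrow> (x, v) \<notin> parcs G"
  using triangle_free edge arcs_symmetric unfolding triangle_free_def by blast

lemma verts_H: "pverts H = insert w (pverts G - {u, v})"
  by (simp add: contract_edge_def Let_def)

lemma arcs_H_iff:
  assumes "x \<noteq> w" "y \<noteq> w"
  shows "(x, y) \<in> parcs H \<longleftrightarrow> (x, y) \<in> parcs G \<and> x \<notin> {u, v} \<and> y \<notin> {u, v}"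
  using assms by (auto simp: contract_edge_def Let_def)

lemma arcs_H_to_w_iff:
  assumes "x \<noteq> u" "x \<noteq> v"
  shows "(x, w) \<in> parcs H \<longleftrightarrow> (x, u) \<in> parcs G \<or> (x, v) \<in> parcs G"
  using assms fresh
  by (auto simp: contract_edge_def Let_def neighbors_def
      dest: in_arcsD1 in_arcsD2 intro: arcs_symmetric)

text \<open>With no common neighbor of \<open>u\<close> and \<open>v\<close>, no two edges merge at
  \<open>w\<close>. The 2 removes \<open>u\<close> and \<open>v\<close> from each other's
  neighborhoods; both degrees are positive, so the subtraction does not truncate.\<close>

lemma degree_H_w: "degree H w = degree G u + degree G v - 2"
proof -
  let ?Nu = "neighbors G u - {v}" and ?Nv = "neighbors G v - {u}"
  have "neighbors H w = ?Nu \<union> ?Nv"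
    using w_neq_uv fresh
    by (auto simp: contract_edge_def Let_def neighbors_def dest: in_arcsD1 in_arcsD2)
  moreover have "?Nu \<inter> ?Nv = {}"
    using no_common_neighbor arcs_symmetric by (auto simp: neighbors_def)
  ultimately have "degree H w = card ?Nu + card ?Nv"
    by (simp add: degree_eq_card_neighbors card_Un_disjoint finite_neighbors)
  moreover have "card (neighbors G u) = Suc (card ?Nu)" "card (neighbors G v) = Suc (card ?Nv)"
    using edge arcs_symmetric[OF edge]
    by (intro card.remove finite_neighbors; simp add: neighbors_def)+
  ultimately show ?thesis
    by (simp add: degree_eq_card_neighbors)
qed

text \<open>
  A vertex adjacent to \<open>u\<close> or \<open>v\<close> is adjacent to only one of them, which \<open>w\<close> replaces.
\<close>

lemma degree_H:
  assumes x: "x \<in> pverts G" "x \<noteq> u" "x \<noteq> v"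
  shows "degree H x = degree G x"
proof -
  let ?f = "\<lambda>y. if y \<in> {u, v} then w else y"
  have "neighbors H x = ?f ` neighbors G x"
  proof (rule set_eqI)
    fix y
    have "x \<noteq> w" using x fresh by auto
    show "y \<in> neighbors H x \<longleftrightarrow> y \<in> ?f ` neighbors G x"
    proof (cases "y = w")
      case True
      then show ?thesis
        using arcs_H_to_w_iff[of x] x fresh
        by (auto simp: neighbors_def image_iff dest: in_arcsD2)
    next
      case False
      then show ?thesis
        using arcs_H_iff[OF \<open>x \<noteq> w\<close> False] x by (auto simp: neighbors_def image_iff)
    qed
  qed
  moreover have "inj_on ?f (neighbors G x)"
    using no_common_neighbor fresh
    by (auto simp: inj_on_def neighbors_def dest: in_arcsD2)
  ultimately show ?thesis
    unfolding degree_eq_card_neighbors by (metis card_image)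
qed

lemma ascending_path_H_iff:
  assumes "u \<notin> set p" "v \<notin> set p" "w \<notin> set p"
  shows "ascending_path H p \<longleftrightarrow> ascending_path G p"
proof -
  have "successively (\<lambda>x y. (x, y) \<in> parcs H \<and> degree H x \<le> degree H y) p \<longleftrightarrow>
      successively (\<lambda>x y. (x, y) \<in> parcs G \<and> degree G x \<le> degree G y) p" if "set p \<subseteq> pverts G"
  proof (rule successively_cong[OF _ refl])
    fix x y assume "x \<in> set p" "y \<in> set p"
    then have "degree H x = degree G x" "degree H y = degree G y"
        "x \<notin> {u, v, w}" "y \<notin> {u, v, w}"
      using assms that by (auto intro!: degree_H)
    then show "(x, y) \<in> parcs H \<and> degree H x \<le> degree H y \<longleftrightarrow>
        (x, y) \<in> parcs G \<and> degree G x \<le> degree G y"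
      using arcs_H_iff[of x y] by auto
  qed
  moreover have "set p \<subseteq> pverts H \<longleftrightarrow> set p \<subseteq> pverts G"
    using assms by (auto simp: verts_H)
  ultimately show ?thesis
    by (auto simp: ascending_path_def)
qed

lemma ascending_path_G_imp_H:
  assumes "ascending_path G p" "u \<notin> set p" "v \<notin> set p"
  shows "ascending_path H p"
  using assms fresh ascending_path_H_iff[of p] by (auto simp: ascending_path_def)

lemma ascending_path_H_imp_G:
  assumes "ascending_path H p" "w \<notin> set p"
  shows "ascending_path G p"
  using assms w_neq_uv ascending_path_H_iff[of p] by (auto simp: ascending_path_def verts_H)

lemma ascending_path_H_snoc_w:
  assumes p: "ascending_path G p" "u \<notin> set p" "v \<notin> set p"
    and last: "p \<noteq> [] \<Longrightarrow> (last p, u) \<in> parcs G \<or> (last p, v) \<in> parcs G"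
      "p \<noteq> [] \<Longrightarrow> degree G (last p) \<le> degree H w"
  shows "ascending_path H (p @ [w])"
proof -
  have "w \<notin> set p" using p(1) fresh by (auto simp: ascending_path_def)
  moreover have "last p \<in> pverts G" "last p \<noteq> u" "last p \<noteq> v" if "p \<noteq> []"
    using p last_in_set[OF that] by (auto simp: ascending_path_def)
  ultimately show ?thesis
    using ascending_path_G_imp_H[OF p] last arcs_H_to_w_iff[of "last p"] degree_H[of "last p"]
    by (auto simp: ascending_path_append ascending_path_Cons verts_H)
qed

section \<open>The lower bound\<close>

text \<open>Apart from the case of empty \<open>A\<close> and \<open>B\<close>, the paths
  \<open>A @ [w]\<close>, \<open>B @ [w]\<close> and \<open>C\<close> of \<open>H\<close> together
  have exactly as many vertices as the given path: the two copies of \<open>w\<close> pay for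
  \<open>u\<close> and \<open>v\<close>.\<close>

lemma length_le_of_ascending_path_through_both:
  assumes p: "ascending_path G (A @ u # B @ v # C)"
  shows "length (A @ u # B @ v # C) \<le> 3 * mp H"
proof -
  have asc: "ascending_path G A" "ascending_path G B" "ascending_path G C"
    and avoid: "u \<notin> set A" "v \<notin> set A" "u \<notin> set B" "v \<notin> set B" "u \<notin> set C" "v \<notin> set C"
    using p by (auto simp: ascending_path_append ascending_path_Cons)
  have C: "length C \<le> mp H"
    using ascending_path_G_imp_H asc avoid by (intro H.ascending_path_length_le_mp) auto
  have pos: "1 \<le> mp H"
    by (rule H.mp_pos) (simp add: verts_H)
  show ?thesis
  proof (cases "A = [] \<and> B = []")
    case True
    \<comment> \<open>The path has \<open>length C + 2\<close> vertices, and 2 is at most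
      \<open>2 * mp H\<close>.\<close>
    then show ?thesis using C pos by simp
  next
    case False
    have A: "(last A, u) \<in> parcs G \<and> degree G (last A) \<le> degree G u" if "A \<noteq> []"
      using p that by (auto simp: ascending_path_append ascending_path_Cons)
    have B: "(u, hd B) \<in> parcs G \<and> (last B, v) \<in> parcs G \<and> degree G (last B) \<le> degree G v"
      if "B \<noteq> []"
      using p that by (auto simp: ascending_path_append ascending_path_Cons)
    \<comment> \<open>\<open>B\<close> may separate \<open>u\<close> from \<open>v\<close>, so the
      comparison must be carried along the path by transitivity.\<close>
    have uv: "degree G u \<le> degree G v"
    proof -
      have "sorted_wrt (\<lambda>x y. degree G x \<le> degree G y) (A @ u # B @ v # C)"
        using p successively_conv_sorted_wrt[of "\<lambda>x y. degree G x \<le> degree G y"]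
        by (auto simp: ascending_path_def successively_conj transp_def)
      then show ?thesis by (auto simp: sorted_wrt_append)
    qed
    \<comment> \<open>Besides \<open>v\<close>, the vertex \<open>u\<close> has a neighbor on the
      path: the start of \<open>B\<close> or the end of \<open>A\<close>.\<close>
    have "2 \<le> degree G u"
    proof (cases "A = []")
      case True
      with False have "B \<noteq> []" by simp
      with avoid have "hd B \<noteq> v" by (metis hd_in_set)
      then show ?thesis using two_le_degree[OF edge] B[OF \<open>B \<noteq> []\<close>] by blast
    next
      case False
      with avoid have "last A \<noteq> v" by (metis last_in_set)
      then show ?thesis
        using two_le_degree[OF edge] A[OF False] arcs_symmetric by blast
    qed
    then have w: "degree G v \<le> degree H w"
      by (simp add: degree_H_w)
    have "ascending_path H (A @ [w])" "ascending_path H (B @ [w])"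
      using asc avoid A B uv w by (auto intro!: ascending_path_H_snoc_w)
    then have "length A + 1 \<le> mp H" "length B + 1 \<le> mp H"
      using H.ascending_path_length_le_mp by fastforce+
    then show ?thesis using C by simp
  qed
qed

text \<open>If \<open>v\<close> is not on the path, then \<open>u\<close> cuts it into two paths
  that survive in \<open>H\<close>, and \<open>u\<close> itself accounts for the third
  \<open>mp H\<close>. The order with \<open>v\<close> before \<open>u\<close> is left to the
  hypothesis \<open>both\<close>, to be supplied by exchanging \<open>u\<close> and
  \<open>v\<close>.\<close>

lemma length_le_of_ascending_path_through_u:
  assumes p: "ascending_path G p" and u: "u \<in> set p"
    and both: "\<And>A B C. p = A @ v # B @ u # C \<Longrightarrow> length p \<le> 3 * mp H"
  shows "length p \<le> 3 * mp H"
proof -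
  obtain A B where AB: "p = A @ u # B"
    using u by (metis split_list)
  show ?thesis
  proof (cases "v \<in> set p")
    case True
    then consider "v \<in> set A" | "v \<in> set B"
      using AB u_neq_v by auto
    then show ?thesis
    proof cases
      case 1
      then obtain A' C where "A = A' @ v # C" by (metis split_list)
      then show ?thesis using AB both[of A' C B] by simp
    next
      case 2
      then obtain B' C where "B = B' @ v # C" by (metis split_list)
      then show ?thesis
        using p AB length_le_of_ascending_path_through_both[of A B' C] by simp
    qed
  next
    case False
    then have "ascending_path H A" "ascending_path H B"
      using p AB by (auto intro!: ascending_path_G_imp_H
          simp: ascending_path_append ascending_path_Cons)
    then have "length A \<le> mp H" "length B \<le> mp H"
      by (auto intro: H.ascending_path_length_le_mp)
    moreover have "1 \<le> mp H"
      by (rule H.mp_pos) (simp add: verts_H)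
    ultimately show ?thesis using AB by simp
  qed
qed

lemma mp_le_three_mp_contract_edge: "mp G \<le> 3 * mp H"
proof -
  \<comment> \<open>Contraction is symmetric in \<open>u\<close> and \<open>v\<close>, so the
    previous lemmas also hold with their roles exchanged.\<close>
  interpret swap: edge_contraction G v u w by (rule edge_contraction_swap)
  obtain p where p: "ascending_path G p" "length p = mp G"
    using ex_ascending_path_length_eq_mp uv_in_verts by blast
  have both: "length p \<le> 3 * mp H" if "p = A @ u # B @ v # C \<or> p = A @ v # B @ u # C" for A B C
    using p that length_le_of_ascending_path_through_both[of A B C]
      swap.length_le_of_ascending_path_through_both[of A B C]
    by (auto simp: contract_edge_swap)
  consider "u \<in> set p" | "v \<in> set p" | "u \<notin> set p" "v \<notin> set p" by blast
  then have "length p \<le> 3 * mp H"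
  proof cases
    case 1
    with p(1) show ?thesis
      by (rule length_le_of_ascending_path_through_u) (rule both, rule disjI2)
  next
    case 2
    with p(1) show ?thesis
      by (rule swap.length_le_of_ascending_path_through_u[unfolded contract_edge_swap[of G v u w]])
        (rule both, rule disjI1)
  next
    case 3
    with p(1) have "length p \<le> mp H"
      by (intro H.ascending_path_length_le_mp ascending_path_G_imp_H)
    then show ?thesis by simp
  qed
  with p show ?thesis by simp
qed

section \<open>The upper bound\<close>

lemma mp_contract_edge_le_two_mp: "mp H \<le> 2 * mp G"
proof -
  have pos: "1 \<le> mp G"
    using mp_pos uv_in_verts by blast
  obtain p where p: "ascending_path H p" "length p = mp H"
    using H.ex_ascending_path_length_eq_mp by (auto simp: verts_H)
  have "length p \<le> 2 * mp G"
  proof (cases "w \<in> set p")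
    case False
    then show ?thesis
      using ascending_path_length_le_mp[OF ascending_path_H_imp_G[OF p(1)]] by simp
  next
    case True
    then obtain A B where AB: "p = A @ w # B" by (metis split_list)
    have avoid: "u \<notin> set p" "v \<notin> set p"
      using p(1) w_neq_uv by (auto simp: ascending_path_def verts_H)
    have asc: "ascending_path G A" "ascending_path G B"
      using p(1) AB by (auto intro!: ascending_path_H_imp_G
          simp: ascending_path_append ascending_path_Cons)
    then have le: "length A \<le> mp G" "length B \<le> mp G"
      by (auto intro: ascending_path_length_le_mp)
    \<comment> \<open>The inequality is strict to leave room for \<open>w\<close>. If it fails, both
      pieces are longest possible in \<open>G\<close>, so neither can be prolonged.\<close>
    have "length A + length B < 2 * mp G"
    proof (rule ccontr)
      assume "\<not> ?thesis"
      with le have len: "length A = mp G" "length B = mp G" by auto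
      with pos have ne: "A \<noteq> []" "B \<noteq> []" by auto
      define a b where "a = last A" and "b = hd B"
      have a: "a \<in> pverts G" "a \<noteq> u" "a \<noteq> v" and b: "b \<in> pverts G" "b \<noteq> u" "b \<noteq> v"
        using asc avoid last_in_set[OF ne(1)] hd_in_set[OF ne(2)]
        by (auto simp: ascending_path_def AB a_def b_def)
      have "(a, w) \<in> parcs H" "(w, b) \<in> parcs H"
        and aw: "degree G a \<le> degree H w" and wb: "degree H w \<le> degree G b"
        using p(1) ne a b degree_H[of a] degree_H[of b]
        by (auto simp: AB ascending_path_append ascending_path_Cons a_def b_def)
      then obtain x y where x: "(a, x) \<in> parcs G" "x \<in> {u, v}"
        and y: "(y, b) \<in> parcs G" "y \<in> {u, v}"
        using a b arcs_H_to_w_iff[of a] arcs_H_to_w_iff[of b] H.arcs_symmetric arcs_symmetric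
        by blast
      have "degree G x < degree G a"
      proof (rule ccontr)
        assume "\<not> ?thesis"
        then have "ascending_path G (A @ [x])"
          using asc x uv_in_verts avoid
          by (auto simp: AB ascending_path_append ascending_path_Cons a_def)
        from ascending_path_length_le_mp[OF this] len show False by simp
      qed
      moreover have yb: "degree G b < degree G y"
      proof (rule ccontr)
        assume "\<not> ?thesis"
        then have "ascending_path G (y # B)"
          using asc y uv_in_verts avoid
          by (auto simp: AB ascending_path_Cons b_def)
        from ascending_path_length_le_mp[OF this] len show False by simp
      qed
      \<comment> \<open>Otherwise \<open>x\<close> would have degree smaller than \<open>a\<close>,
        hence at most that of \<open>w\<close> and of \<open>b\<close>, yet larger than
        \<open>b\<close>.\<close>
      ultimately have "x \<noteq> y" using aw wb by auto
      then have xy: "(x, y) \<in> parcs G" and "degree H w = degree G x + degree G y - 2"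
        using x y edge arcs_symmetric[OF edge] by (auto simp: degree_H_w)
      \<comment> \<open>The two neighbors of \<open>x\<close> are \<open>a\<close> and
        \<open>y\<close>, distinct because \<open>a\<close> is neither \<open>u\<close> nor
        \<open>v\<close>.\<close>
      moreover have "2 \<le> degree G x"
        using two_le_degree[OF xy, of a] x(1) y(2) a arcs_symmetric by blast
      ultimately show False using yb wb by simp
    qed
    then show ?thesis using AB by simp
  qed
  with p show ?thesis by simp
qed

end

theorem theorem2p3:
  fixes G :: "'a pair_pre_digraph" and u v w :: 'a
  assumes "pair_graph G"
    and "triangle_free G"
    and "(u, v) \<in> parcs G"
    and "w \<notin> pverts G"
  shows "real (mp G) / 3 \<le> real (mp (contract_edge G u v w)) \<and>
         real (mp (contract_edge G u v w)) \<le> 2 * real (mp G)"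
proof -
  interpret edge_contraction G u v w
    using assms by (simp add: edge_contraction_def edge_contraction_axioms_def)
  show ?thesis
    using mp_le_three_mp_contract_edge mp_contract_edge_le_two_mp by linarith
qed

end
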